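(* Let $\mathcal{F}_n$ be a family of $n$ conditional events and $E|H$ a further conditional event with $H\nsubseteq E$. Assume that $\mathcal{F}_n$ p-entails $E|H$. Then the class $\mathcal{K}=\{\mathcal{S}\subseteq\mathcal{F}_n,\ \mathcal{S}\neq\emptyset:\ \mathcal{C}(\mathcal{S})\subseteq E|H\}$ is nonempty and has a greatest element $\mathcal{S}^*$ (with respect to set inclusion), i.e. there is $\mathcal{S}^*\in\mathcal{K}$ with $\mathcal{S}\subseteq\mathcal{S}^*$ for every $\mathcal{S}\in\mathcal{K}$.
   Context: Events are elements of a Boolean algebra with sure event $\Omega$ and impossible event $\emptyset$; $AB$ is conjunction, $A\vee B$ disjunction, $A^c$ negation, $A\subseteq B$ logical implication; an event is identified with its indicator. A conditional event $E|H$ is given by events $E,H$ with $H\neq\emptyset$; it is true if $EH$ is true, false if $E^cH$ is true, void if $H^c$ is true. $A|H=B|K$ means $AH=BK$ and $H=K$. Coherence. An assessment $(p_1,\ldots,p_n)$ of real numbers, with $p_i=P(E_i|H_i)$, on a finite list of conditional events $E_1|H_1,\ldots,E_n|H_n$ is coherent if for every nonempty $J\subseteq\{1,\ldots,n\}$ and all real numbers $s_j$ ($j\in J$), the random gain $\mathcal{G}=\sum_{j\in J}s_jH_j(E_j-p_j)$, restricted to $\bigvee_{j\in J}H_j$ (i.e. considering its finitely many values on the possible outcomes implying $\bigvee_{j\in J}H_j$), satisfies $\min\mathcal{G}\le 0\le\max\mathcal{G}$. p-consistency. A family $\{E_i|H_i: i=1,\ldots,n\}$ is p-consistent if for every $(\alpha_1,\ldots,\alpha_n)\in[0,1)^n$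 there is a coherent assessment $(p_1,\ldots,p_n)$ on it with $p_i\ge\alpha_i$ for all $i$. p-entailment. The statement that a family $\{E_i|H_i: i=1,\ldots,n\}$ p-entails $B|A$ means that the family is p-consistent and there is a nonempty $J\subseteq\{1,\ldots,n\}$ such that for every $\alpha\in[0,1)$ there exist $\alpha_i\in[0,1)$, $i\in J$, such that for all coherent assessments $(z,p_i, i\in J)$ on $\{B|A,\ E_i|H_i,\ i\in J\}$, with $z=P(B|A)$, $p_i=P(E_i|H_i)$: if $p_i\ge\alpha_i$ for every $i\in J$, then $z\ge\alpha$. Quasi conjunction. For a nonempty finite family $\mathcal{S}=\{E_1|H_1,\ldots,E_s|H_s\}$, $\mathcal{C}(\mathcal{S})$ is the conditional event $\bigwedge_{i=1}^s(E_iH_i\vee H_i^c)\,\big|\,\bigvee_{i=1}^sH_i$. Inclusion (Goodman–Nguyen). $A|H\subseteq B|K$ means $AH\subseteq BK$ and $B^cK\subseteq A^cH$. *)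

theory Defs
  imports Complex_Main "HOL-Library.FuncSet"
begin

unbundle lattice_syntax

text \<open>
  A conditional event \<open>E|H\<close> (with \<open>H \<noteq> \<bottom>\<close>) is represented by the normalised pair \<open>(E \<sqinter> H, H)\<close>, so
  that HOL equality is the equality of conditional events: \<open>A|H = B|K\<close> iff \<open>A \<sqinter> H = B \<sqinter> K\<close> and
  \<open>H = K\<close>. Events range over an arbitrary type of class \<open>boolean_algebra\<close>; since this class admits the
  one-element algebra, in which there are no conditional events, \<open>H \<noteq> \<bottom>\<close> is a predicate rather than
  built into a type.
\<close>

type_synonym 'a cond_event = "'a \<times> 'a"

definition cond :: "'a::boolean_algebra \<Rightarrow> 'a \<Rightarrow> 'a cond_event" where
  "cond E H = (E \<sqinter> H, H)"

definition is_cond_event :: "'a::boolean_algebra cond_event \<Rightarrow> bool" where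
  "is_cond_event c \<longleftrightarrow> (\<exists>E H. H \<noteq> \<bottom> \<and> c = cond E H)"

abbreviation conseq :: "'a cond_event \<Rightarrow> 'a" where "conseq \<equiv> fst"
abbreviation antec :: "'a cond_event \<Rightarrow> 'a" where "antec \<equiv> snd"

lemma cond_eq_iff: "cond A H = cond B K \<longleftrightarrow> A \<sqinter> H = B \<sqinter> K \<and> H = K"
  by (auto simp: cond_def)

datatype truth_value = Is_True | Is_False | Is_Void

fun status_event :: "truth_value \<Rightarrow> 'a::boolean_algebra cond_event \<Rightarrow> 'a" where
  "status_event Is_True c = conseq c \<sqinter> antec c"
| "status_event Is_False c = - conseq c \<sqinter> antec c"
| "status_event Is_Void c = - antec c"

text \<open>
  The possible outcomes relative to a finite nonempty family \<open>C j\<close>, \<open>j \<in> J\<close>: the constituents, i.e. the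
  possible conjunctions obtained by choosing for each \<open>j\<close> one of \<open>E\<^sub>j \<sqinter> H\<^sub>j\<close>, \<open>- E\<^sub>j \<sqinter> H\<^sub>j\<close>, \<open>- H\<^sub>j\<close>.
\<close>

definition constituents :: "'i set \<Rightarrow> ('i \<Rightarrow> 'a::boolean_algebra cond_event) \<Rightarrow> 'a set" where
  "constituents J C =
     {w. w \<noteq> \<bottom> \<and> (\<exists>t. w = \<Sqinter>\<^sub>f\<^sub>i\<^sub>n ((\<lambda>j. status_event (t j) (C j)) ` J))}"

text \<open>
  The value of the indicator of \<open>A\<close> at the outcome \<open>w\<close>. A constituent \<open>w\<close> decides each \<open>H\<^sub>j\<close>, and decides
  \<open>E\<^sub>j\<close> whenever it implies \<open>H\<^sub>j\<close>; if it implies \<open>- H\<^sub>j\<close>, the corresponding summand of the gain vanishes.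
\<close>

definition indic :: "'a::boolean_algebra \<Rightarrow> 'a \<Rightarrow> real" where
  "indic A w = of_bool (w \<le> A)"

definition gain ::
  "'i set \<Rightarrow> ('i \<Rightarrow> 'a::boolean_algebra cond_event) \<Rightarrow> ('i \<Rightarrow> real) \<Rightarrow> ('i \<Rightarrow> real) \<Rightarrow> 'a \<Rightarrow> real" where
  "gain J C p s w = (\<Sum>j\<in>J. s j * indic (antec (C j)) w * (indic (conseq (C j)) w - p j))"

definition gain_values ::
  "'i set \<Rightarrow> ('i \<Rightarrow> 'a::boolean_algebra cond_event) \<Rightarrow> ('i \<Rightarrow> real) \<Rightarrow> ('i \<Rightarrow> real) \<Rightarrow> real set" where
  "gain_values J C p s =
     gain J C p s ` {w \<in> constituents J C. w \<le> \<Squnion>\<^sub>f\<^sub>i\<^sub>n ((\<lambda>j. antec (C j)) ` J)}"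

definition coherent ::
  "'i set \<Rightarrow> ('i \<Rightarrow> 'a::boolean_algebra cond_event) \<Rightarrow> ('i \<Rightarrow> real) \<Rightarrow> bool" where
  "coherent I C p \<longleftrightarrow>
     (\<forall>J s. J \<subseteq> I \<longrightarrow> J \<noteq> {} \<longrightarrow> Min (gain_values J C p s) \<le> 0 \<and> 0 \<le> Max (gain_values J C p s))"

definition p_consistent :: "'i set \<Rightarrow> ('i \<Rightarrow> 'a::boolean_algebra cond_event) \<Rightarrow> bool" where
  "p_consistent I C \<longleftrightarrow>
     (\<forall>\<alpha>. (\<forall>i\<in>I. \<alpha> i \<in> {0..<1}) \<longrightarrow> (\<exists>p. coherent I C p \<and> (\<forall>i\<in>I. \<alpha> i \<le> p i)))"

text \<open>
  The family \<open>{B|A, E\<^sub>i|H\<^sub>i, i \<in> J}\<close> is indexed by \<open>None\<close> (for \<open>B|A\<close>) and \<open>Some i\<close>, so that \<open>B|A\<close> may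
  also occur among the \<open>E\<^sub>i|H\<^sub>i\<close>.
\<close>

definition p_entails ::
  "'i set \<Rightarrow> ('i \<Rightarrow> 'a::boolean_algebra cond_event) \<Rightarrow> 'a cond_event \<Rightarrow> bool" where
  "p_entails I C D \<longleftrightarrow>
     p_consistent I C \<and>
     (\<exists>J. J \<subseteq> I \<and> J \<noteq> {} \<and>
       (\<forall>a::real. a \<in> {0..<1} \<longrightarrow>
         (\<exists>\<alpha>. (\<forall>i\<in>J. \<alpha> i \<in> {0..<1}) \<and>
           (\<forall>z p. coherent (insert None (Some ` J)) (case_option D C) (case_option z p) \<longrightarrow>
              (\<forall>i\<in>J. \<alpha> i \<le> p i) \<longrightarrow> a \<le> z))))"

definition quasi_conj :: "'a::boolean_algebra cond_event set \<Rightarrow> 'a cond_event" where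
  "quasi_conj S =
     cond (\<Sqinter>\<^sub>f\<^sub>i\<^sub>n ((\<lambda>c. (conseq c \<sqinter> antec c) \<squnion> - antec c) ` S)) (\<Squnion>\<^sub>f\<^sub>i\<^sub>n (antec ` S))"

text \<open>Goodman--Nguyen inclusion.\<close>

definition gn_incl :: "'a::boolean_algebra cond_event \<Rightarrow> 'a cond_event \<Rightarrow> bool" where
  "gn_incl c d \<longleftrightarrow>
     conseq c \<sqinter> antec c \<le> conseq d \<sqinter> antec d \<and>
     - conseq d \<sqinter> antec d \<le> - conseq c \<sqinter> antec c"

definition qc_class ::
  "'a::boolean_algebra cond_event set \<Rightarrow> 'a cond_event \<Rightarrow> 'a cond_event set set" where
  "qc_class F D = {S. S \<subseteq> F \<and> S \<noteq> {} \<and> gn_incl (quasi_conj S) D}"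

text \<open>The minimum and maximum in the definition of coherence are taken over finite nonempty sets.\<close>

lemma finite_gain_values:
  assumes "finite J" "J \<noteq> {}"
  shows "finite (gain_values J C p s)"
proof -
  have "finite (UNIV :: truth_value set)"
    by (rule finite_subset[of _ "{Is_True, Is_False, Is_Void}"]) (use truth_value.exhaust in auto)
  hence fin: "finite (PiE J (\<lambda>_. UNIV :: truth_value set))"
    using assms by (intro finite_PiE) auto
  have "constituents J C \<subseteq>
      (\<lambda>t. \<Sqinter>\<^sub>f\<^sub>i\<^sub>n ((\<lambda>j. status_event (t j) (C j)) ` J)) ` PiE J (\<lambda>_. UNIV)"
  proof
    fix w assume "w \<in> constituents J C"
    then obtain t where "w = \<Sqinter>\<^sub>f\<^sub>i\<^sub>n ((\<lambda>j. status_event (t j) (C j)) ` J)"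
      by (auto simp: constituents_def)
    also have "(\<lambda>j. status_event (t j) (C j)) ` J =
        (\<lambda>j. status_event (restrict t J j) (C j)) ` J" by auto
    finally show "w \<in> (\<lambda>t. \<Sqinter>\<^sub>f\<^sub>i\<^sub>n ((\<lambda>j. status_event (t j) (C j)) ` J)) ` PiE J (\<lambda>_. UNIV)"
      by (intro image_eqI[of _ _ "restrict t J"]) auto
  qed
  hence "finite (constituents J C)" using fin finite_surj by blast
  thus ?thesis by (simp add: gain_values_def)
qed

lemma constituent_below:
  assumes "finite J" "J \<noteq> {}" "x \<noteq> \<bottom>"
  shows "\<exists>w \<in> constituents J C. w \<sqinter> x \<noteq> \<bottom>"
  using assms
proof -
  have "\<exists>t. \<Sqinter>\<^sub>f\<^sub>i\<^sub>n ((\<lambda>j. status_event (t j) (C j)) ` J) \<sqinter> x \<noteq> \<bottom>"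
    using assms
  proof (induction J arbitrary: x rule: finite_ne_induct)
    case (singleton j)
    have "x = (status_event Is_True (C j) \<sqinter> x) \<squnion> (status_event Is_False (C j) \<sqinter> x)
            \<squnion> (status_event Is_Void (C j) \<sqinter> x)"
      by (simp flip: inf_sup_distrib2)
    then obtain v where "status_event v (C j) \<sqinter> x \<noteq> \<bottom>"
      using singleton by (metis sup_bot_left)
    thus ?case by (intro exI[of _ "\<lambda>_. v"]) simp
  next
    case (insert j J)
    have "x = (status_event Is_True (C j) \<sqinter> x) \<squnion> (status_event Is_False (C j) \<sqinter> x)
            \<squnion> (status_event Is_Void (C j) \<sqinter> x)"
      by (simp flip: inf_sup_distrib2)
    then obtain v where "status_event v (C j) \<sqinter> x \<noteq> \<bottom>"
      using insert.prems by (metis sup_bot_left)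
    from insert.IH[OF this] obtain t where
      t: "\<Sqinter>\<^sub>f\<^sub>i\<^sub>n ((\<lambda>j. status_event (t j) (C j)) ` J) \<sqinter> (status_event v (C j) \<sqinter> x) \<noteq> \<bottom>" by blast
    have "(\<lambda>i. status_event ((t(j := v)) i) (C i)) ` J = (\<lambda>j. status_event (t j) (C j)) ` J"
      using insert.hyps by auto
    hence "\<Sqinter>\<^sub>f\<^sub>i\<^sub>n ((\<lambda>i. status_event ((t(j := v)) i) (C i)) ` insert j J) =
        status_event v (C j) \<sqinter> \<Sqinter>\<^sub>f\<^sub>i\<^sub>n ((\<lambda>j. status_event (t j) (C j)) ` J)"
      using insert.hyps by (simp add: Inf_fin.insert)
    with t show ?case by (intro exI[of _ "t(j := v)"]) (simp add: ac_simps)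
  qed
  thus ?thesis unfolding constituents_def by fastforce
qed

lemma gain_values_nonempty:
  assumes "finite J" "J \<noteq> {}" "\<And>j. j \<in> J \<Longrightarrow> is_cond_event (C j)"
  shows "gain_values J C p s \<noteq> {}"
proof -
  obtain j where j: "j \<in> J" using assms by blast
  have "antec (C j) \<noteq> \<bottom>" using assms(3)[OF j] by (auto simp: is_cond_event_def cond_def)
  from constituent_below[OF assms(1,2) this, of C] obtain w where
    w: "w \<in> constituents J C" "w \<sqinter> antec (C j) \<noteq> \<bottom>" by blast
  then obtain t where t: "w = \<Sqinter>\<^sub>f\<^sub>i\<^sub>n ((\<lambda>j. status_event (t j) (C j)) ` J)"
    by (auto simp: constituents_def)
  have le: "w \<le> status_event (t j) (C j)"
    unfolding t using j assms(1) by (intro Inf_fin.coboundedI) auto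
  have "w \<le> antec (C j)"
  proof (cases "t j")
    case Is_Void
    hence "w \<sqinter> antec (C j) \<le> - antec (C j) \<sqinter> antec (C j)"
      using le by (intro inf_mono) auto
    with w(2) show ?thesis by (simp add: bot_unique)
  qed (use le in auto)
  also have "\<dots> \<le> \<Squnion>\<^sub>f\<^sub>i\<^sub>n ((\<lambda>j. antec (C j)) ` J)"
    using j assms(1) by (intro Sup_fin.coboundedI) auto
  finally show ?thesis using w(1) by (auto simp: gain_values_def)
qed

end

theory Submission
  imports Defs
begin

text \<open>
  Two independent facts give the theorem.

  The class of nonempty \<open>S\<close> with \<open>\<C>(S) \<subseteq> E|H\<close> is closed under union: the quasi conjunction is false as
  soon as one member is false, and it is true when no member is false and at least one is true; in the
  latter case one of the two smaller quasi conjunctions is already true.  In a finite family the union of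
  the whole class is therefore its greatest element, once the class is nonempty
  (\<open>gn_incl_quasi_conj_Un\<close>).

  Nonemptiness is where entailment enters, and the argument is by contradiction.  Betting one unit on
  each member of a subfamily shows that p-consistency provides an outcome at which no member is false and
  some member is true (\<open>p_consistent_imp_quasi_conj_verifiable\<close>).  If no nonempty \<open>S\<close> satisfies
  \<open>\<C>(S) \<subseteq> E|H\<close>, the same kind of outcome survives when the negation of \<open>E|H\<close> joins the subfamily: failure
  of the inclusion means precisely that some outcome falsifies no member of \<open>S\<close>, does not verify \<open>E|H\<close>,
  and leaves \<open>S\<close> and \<open>E|H\<close> not all void (\<open>not_gn_incl_quasi_conj\<close>); for \<open>S\<close> empty this is what
  \<open>\<not> H \<le> E\<close> says.  At such an outcome every bet against the assessment that gives probability \<open>1\<close> to the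
  premises and \<open>0\<close> to \<open>E|H\<close> has gain \<open>0\<close>, so that assessment is coherent (\<open>coherent_of_bool\<close>), which
  entailment forbids.
\<close>

section \<open>Quasi conjunction and inclusion\<close>

text \<open>
  Outside its antecedent a quasi conjunction has all members void, so not being false amounts to
  no member being false.
\<close>

lemma conseq_quasi_conj_sup_not_antec:
  assumes "finite S" "S \<noteq> {}"
  shows "conseq (quasi_conj S) \<squnion> - antec (quasi_conj S) =
    \<Sqinter>\<^sub>f\<^sub>i\<^sub>n ((\<lambda>c. (conseq c \<sqinter> antec c) \<squnion> - antec c) ` S)"
proof -
  have "- \<Squnion>\<^sub>f\<^sub>i\<^sub>n (antec ` S) \<le> (conseq c \<sqinter> antec c) \<squnion> - antec c" if "c \<in> S" for c
  proof -
    have "antec c \<le> \<Squnion>\<^sub>f\<^sub>i\<^sub>n (antec ` S)"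
      using assms that by (intro Sup_fin.coboundedI) auto
    thus ?thesis by (simp add: le_supI2)
  qed
  hence "- \<Squnion>\<^sub>f\<^sub>i\<^sub>n (antec ` S) \<le> \<Sqinter>\<^sub>f\<^sub>i\<^sub>n ((\<lambda>c. (conseq c \<sqinter> antec c) \<squnion> - antec c) ` S)"
    using assms by (intro Inf_fin.boundedI) auto
  thus ?thesis
    by (simp add: quasi_conj_def cond_def sup_inf_distrib2 sup_absorb1)
qed

lemma gn_incl_quasi_conj_Un:
  assumes fin: "finite S" "finite T" and ne: "S \<noteq> {}" "T \<noteq> {}"
    and incl: "gn_incl (quasi_conj S) d" "gn_incl (quasi_conj T) d"
  shows "gn_incl (quasi_conj (S \<union> T)) d"
proof -
  define N where "N S = \<Sqinter>\<^sub>f\<^sub>i\<^sub>n ((\<lambda>c. (conseq c \<sqinter> antec c) \<squnion> - antec c) ` S)" for S :: "'a cond_event set"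
  define V where "V S = \<Squnion>\<^sub>f\<^sub>i\<^sub>n (antec ` S)" for S :: "'a cond_event set"
  have qc: "quasi_conj S = (N S \<sqinter> V S, V S)" for S
    by (simp add: quasi_conj_def cond_def N_def V_def)
  have N: "N (S \<union> T) = N S \<sqinter> N T" and V: "V (S \<union> T) = V S \<squnion> V T"
    using fin ne by (simp_all add: N_def V_def image_Un Inf_fin.union Sup_fin.union)
  have S: "N S \<sqinter> V S \<le> conseq d \<sqinter> antec d" "- conseq d \<sqinter> antec d \<le> - (N S \<sqinter> V S) \<sqinter> V S"
    and T: "N T \<sqinter> V T \<le> conseq d \<sqinter> antec d"
    using incl by (simp_all add: gn_incl_def qc)
  have "N (S \<union> T) \<sqinter> V (S \<union> T) \<le> (N S \<sqinter> V S) \<squnion> (N T \<sqinter> V T)"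
    unfolding N V inf_sup_distrib1 by (intro sup_mono inf_mono) auto
  also have "\<dots> \<le> conseq d \<sqinter> antec d"
    using S(1) T by (rule sup_least)
  finally have true: "N (S \<union> T) \<sqinter> V (S \<union> T) \<le> conseq d \<sqinter> antec d" .
  have "- conseq d \<sqinter> antec d \<le> - N S \<sqinter> V S"
    using S(2) by (simp add: inf_sup_distrib2)
  also have "\<dots> \<le> - (N (S \<union> T) \<sqinter> V (S \<union> T)) \<sqinter> V (S \<union> T)"
    unfolding N V by (intro inf_mono) (auto intro: le_supI1)
  finally show ?thesis
    using true by (simp add: gn_incl_def qc)
qed

text \<open>
  The two clauses of the inclusion can fail in two ways: an outcome verifies \<open>\<C>(S)\<close> but not \<open>d\<close>, or it
  falsifies \<open>d\<close> but not \<open>\<C>(S)\<close>.  Either one serves as \<open>x\<close>.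
\<close>

lemma not_gn_incl_quasi_conj:
  assumes "finite S" "S \<noteq> {}" "\<not> gn_incl (quasi_conj S) d"
  obtains x where "x \<noteq> \<bottom>" "x \<le> antec d \<squnion> \<Squnion>\<^sub>f\<^sub>i\<^sub>n (antec ` S)"
    "x \<le> - status_event Is_True d" "\<And>c. c \<in> S \<Longrightarrow> x \<le> - status_event Is_False c"
proof -
  define q where "q = quasi_conj S"
  have q_le: "conseq q \<le> \<Squnion>\<^sub>f\<^sub>i\<^sub>n (antec ` S)" and q_normal: "conseq q \<sqinter> antec q = conseq q"
    by (simp_all add: q_def quasi_conj_def cond_def ac_simps)
  have not_false: "x \<le> - status_event Is_False c"
    if "x \<le> conseq q \<squnion> - antec q" "c \<in> S" for x c
  proof -
    have "x \<le> (conseq c \<sqinter> antec c) \<squnion> - antec c"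
      using that assms unfolding q_def conseq_quasi_conj_sup_not_antec[OF assms(1,2)]
      by (meson Inf_fin.coboundedI finite_imageI imageI order_trans)
    thus ?thesis by (simp add: sup_inf_distrib2)
  qed
  from assms(3) consider
      (verified) "\<not> conseq q \<le> conseq d \<sqinter> antec d"
    | (falsified) "\<not> - conseq d \<sqinter> antec d \<le> - conseq q \<sqinter> antec q"
    unfolding gn_incl_def q_def[symmetric] q_normal by blast
  thus thesis
  proof cases
    case verified
    show thesis
    proof (rule that)
      show "conseq q \<sqinter> - status_event Is_True d \<noteq> \<bottom>"
        using verified by (simp only: inf_shunt double_compl status_event.simps not_False_eq_True)
      show "conseq q \<sqinter> - status_event Is_True d \<le> antec d \<squnion> \<Squnion>\<^sub>f\<^sub>i\<^sub>n (antec ` S)"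
        using q_le by (meson inf.coboundedI1 le_supI2)
    qed (auto intro!: not_false intro: le_infI1 simp del: status_event.simps)
  next
    case falsified
    define x where "x = (- conseq d \<sqinter> antec d) \<sqinter> (conseq q \<squnion> - antec q)"
    show thesis
    proof (rule that)
      have "conseq q \<squnion> - antec q = - (- conseq q \<sqinter> antec q)" by simp
      thus "x \<noteq> \<bottom>"
        using falsified unfolding x_def by (simp only: inf_shunt double_compl not_False_eq_True)
      show "x \<le> antec d \<squnion> \<Squnion>\<^sub>f\<^sub>i\<^sub>n (antec ` S)"
        unfolding x_def by (rule le_supI1, rule le_infI1, rule inf.cobounded2)
      show "x \<le> - status_event Is_True d"
        unfolding x_def by (intro le_infI1) (simp add: le_supI1 le_infI1)
    qed (auto intro!: not_false simp: x_def simp del: status_event.simps)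
  qed
qed

section \<open>Coherence and outcomes\<close>

lemma constituent_decides:
  assumes "w \<in> constituents J C" "finite J" "j \<in> J"
  obtains v where "w \<le> status_event v (C j)"
proof -
  obtain t where "w = \<Sqinter>\<^sub>f\<^sub>i\<^sub>n ((\<lambda>j. status_event (t j) (C j)) ` J)"
    using assms(1) by (auto simp: constituents_def)
  hence "w \<le> status_event (t j) (C j)"
    using assms(2,3) by (auto intro: Inf_fin.coboundedI)
  thus thesis by (rule that)
qed

lemma le_compl_imp_not_le:
  fixes w A :: "'a::boolean_algebra"
  assumes "w \<noteq> \<bottom>" "w \<le> - A"
  shows "\<not> w \<le> A"
  using assms by (metis inf.absorb2 inf.orderE inf_shunt)

lemma indic_eq_1: "w \<le> A \<Longrightarrow> indic A w = 1"
  by (simp add: indic_def)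

lemma indic_eq_0: "w \<noteq> \<bottom> \<Longrightarrow> w \<le> - A \<Longrightarrow> indic A w = 0"
  by (simp add: indic_def le_compl_imp_not_le)

text \<open>
  With unit stakes and probabilities near \<open>1\<close>, a true or void member contributes almost nothing to the
  gain and a false one contributes almost \<open>- 1\<close>.  An outcome with nonnegative gain, which coherence
  supplies, therefore falsifies no member.
\<close>

lemma p_consistent_imp_quasi_conj_verifiable:
  assumes "finite I" "\<And>i. i \<in> I \<Longrightarrow> is_cond_event (C i)" "p_consistent I C"
    and J: "J \<subseteq> I" "J \<noteq> {}"
  shows "conseq (quasi_conj (C ` J)) \<noteq> \<bottom>"
proof -
  have finJ: "finite J" using assms(1) J(1) finite_subset by blast
  define m where "m = real (card J)"
  have m: "m \<ge> 1"
    using finJ J(2) by (simp add: m_def Suc_le_eq card_gt_0_iff)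
  \<comment> \<open>Any \<open>a\<close> with \<open>m * (1 - a) < 1\<close> makes a single false member outweigh all the others.\<close>
  define a where "a = 1 - 1 / (2 * m)"
  have "a \<in> {0..<1}" using m by (simp add: a_def field_simps)
  hence "\<exists>p. coherent I C p \<and> (\<forall>i\<in>I. a \<le> p i)"
    using spec[OF assms(3)[unfolded p_consistent_def], of "\<lambda>_. a"] by simp
  then obtain p where p: "coherent I C p" "\<forall>i\<in>I. a \<le> p i" by (elim exE conjE)
  let ?G = "gain_values J C p (\<lambda>_. 1)"
  have "finite ?G" using finJ J(2) by (rule finite_gain_values)
  moreover have "?G \<noteq> {}"
    using finJ J(2) by (rule gain_values_nonempty) (use J(1) assms(2) in blast)
  moreover have "0 \<le> Max ?G" using p(1) J by (simp add: coherent_def)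
  ultimately have "\<exists>g\<in>?G. 0 \<le> g" by (simp add: Max_ge_iff)
  then obtain w where w: "w \<in> constituents J C" "w \<le> \<Squnion>\<^sub>f\<^sub>i\<^sub>n ((\<lambda>j. antec (C j)) ` J)"
    and gain: "0 \<le> gain J C p (\<lambda>_. 1) w"
    by (auto simp: gain_values_def)
  have w_ne: "w \<noteq> \<bottom>" using w(1) by (simp add: constituents_def)
  define g where "g j = indic (antec (C j)) w * (indic (conseq (C j)) w - p j)" for j
  have p_ge: "a \<le> p j" if "j \<in> J" for j using p(2) J(1) that by blast
  have a_less: "a < 1" using m by (simp add: a_def)
  have g_le: "g j \<le> 1 - a" if "j \<in> J" for j
    using p_ge[OF that] a_less by (auto simp: g_def indic_def)
  have not_false: "w \<le> (conseq (C j) \<sqinter> antec (C j)) \<squnion> - antec (C j)" if j: "j \<in> J" for j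
  proof -
    obtain v where v: "w \<le> status_event v (C j)"
      using constituent_decides[OF w(1) finJ j] .
    show ?thesis
    proof (cases v)
      case Is_False
      hence "g j = - p j"
        using v w_ne by (simp add: g_def indic_eq_1 indic_eq_0)
      hence "g j \<le> - a" using p_ge[OF j] by simp
      have "gain J C p (\<lambda>_. 1) w = g j + sum g (J - {j})"
        using finJ j by (simp add: gain_def g_def sum.remove)
      also have "\<dots> \<le> - a + (\<Sum>i\<in>J - {j}. 1 - a)"
        using g_le \<open>g j \<le> - a\<close> by (intro add_mono sum_mono) auto
      also have "\<dots> = m * (1 - a) - 1"
        using finJ j m by (simp add: m_def of_nat_diff algebra_simps)
      also have "\<dots> < 0" using m by (simp add: a_def)
      finally show ?thesis using gain by simp
    qed (use v in \<open>auto intro: le_supI1 le_supI2\<close>)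
  qed
  have "w \<le> \<Sqinter>\<^sub>f\<^sub>i\<^sub>n ((\<lambda>c. (conseq c \<sqinter> antec c) \<squnion> - antec c) ` C ` J)"
    using not_false finJ J(2) by (intro Inf_fin.boundedI) auto
  hence "w \<le> conseq (quasi_conj (C ` J))"
    unfolding quasi_conj_def cond_def fst_conv using w(2) by (simp only: image_image le_inf_iff simp_thms)
  thus ?thesis using w_ne by (auto simp: bot_unique)
qed

text \<open>
  The event \<open>x\<close> describes outcomes at which each conditional event is void or takes the truth value that
  the \<open>0\<close>/\<open>1\<close> assessment predicts; whatever the stakes, the gain is \<open>0\<close> there.
\<close>

lemma coherent_of_bool:
  fixes C :: "'i \<Rightarrow> 'a::boolean_algebra cond_event" and b :: "'i \<Rightarrow> bool"
  assumes "finite I"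
    and ex: "\<And>J. J \<subseteq> I \<Longrightarrow> J \<noteq> {} \<Longrightarrow> \<exists>x. x \<noteq> \<bottom> \<and> x \<le> \<Squnion>\<^sub>f\<^sub>i\<^sub>n ((\<lambda>j. antec (C j)) ` J) \<and>
      (\<forall>j\<in>J. x \<le> - status_event (if b j then Is_False else Is_True) (C j))"
  shows "coherent I C (\<lambda>i. of_bool (b i))"
  unfolding coherent_def
proof (intro allI impI)
  fix J s assume J: "J \<subseteq> I" "J \<noteq> {}"
  let ?p = "\<lambda>i. of_bool (b i) :: real"
  have finJ: "finite J" using assms(1) J(1) finite_subset by blast
  obtain x where x: "x \<noteq> \<bottom>" "x \<le> \<Squnion>\<^sub>f\<^sub>i\<^sub>n ((\<lambda>j. antec (C j)) ` J)"
    "\<And>j. j \<in> J \<Longrightarrow> x \<le> - status_event (if b j then Is_False else Is_True) (C j)"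
    using ex[OF J] by blast
  obtain w where w: "w \<in> constituents J C" "w \<sqinter> x \<noteq> \<bottom>"
    using constituent_below[OF finJ J(2) x(1), of C] by blast
  have w_ne: "w \<noteq> \<bottom>" using w(2) by auto
  have status: "v \<noteq> (if b j then Is_False else Is_True)"
    if "j \<in> J" "w \<le> status_event v (C j)" for v j
  proof
    assume "v = (if b j then Is_False else Is_True)"
    hence "w \<sqinter> x \<le> status_event v (C j) \<sqinter> - status_event v (C j)"
      using that x(3) by (intro inf_mono) auto
    thus False using w(2) by (simp add: bot_unique del: status_event.simps)
  qed
  have "gain J C ?p s w = 0"
    unfolding gain_def
  proof (rule sum.neutral, rule ballI)
    fix j assume j: "j \<in> J"
    obtain v where v: "w \<le> status_event v (C j)"
      using constituent_decides[OF w(1) finJ j] .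
    show "s j * indic (antec (C j)) w * (indic (conseq (C j)) w - ?p j) = 0"
      using status[OF j v] v w_ne by (cases v; cases "b j") (simp_all add: indic_eq_1 indic_eq_0)
  qed
  moreover have "w \<le> \<Squnion>\<^sub>f\<^sub>i\<^sub>n ((\<lambda>j. antec (C j)) ` J)"
  proof -
    have "\<exists>j\<in>J. \<not> w \<le> - antec (C j)"
    proof (rule ccontr)
      assume "\<not> ?thesis"
      hence "antec (C j) \<le> - w" if "j \<in> J" for j
        using that by (metis compl_le_swap1)
      hence "\<Squnion>\<^sub>f\<^sub>i\<^sub>n ((\<lambda>j. antec (C j)) ` J) \<le> - w"
        using finJ J(2) by (intro Sup_fin.boundedI) auto
      hence "x \<le> - w" using x(2) by (rule order_trans[rotated])
      hence "w \<sqinter> x \<le> w \<sqinter> - w" by (intro inf_mono) auto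
      thus False using w(2) by (simp add: bot_unique)
    qed
    then obtain j where j: "j \<in> J" "\<not> w \<le> - antec (C j)" by blast
    obtain v where "w \<le> status_event v (C j)"
      using constituent_decides[OF w(1) finJ j(1)] .
    hence "w \<le> antec (C j)" using j(2) by (cases v) auto
    also have "\<dots> \<le> \<Squnion>\<^sub>f\<^sub>i\<^sub>n ((\<lambda>j. antec (C j)) ` J)"
      using j(1) finJ by (intro Sup_fin.coboundedI) auto
    finally show ?thesis .
  qed
  ultimately have "0 \<in> gain_values J C ?p s"
    using w(1) unfolding gain_values_def by (force intro: image_eqI[of _ _ w])
  thus "Min (gain_values J C ?p s) \<le> 0 \<and> 0 \<le> Max (gain_values J C ?p s)"
    using finite_gain_values[OF finJ J(2), of C ?p s] by simp
qed

section \<open>Entailment and quasi conjunction\<close>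

text \<open>
  If no inclusion held, certainty of the premises would be compatible with probability \<open>0\<close> for \<open>D\<close>.
  Coherence of that assessment is tested on each subfamily, according to whether it contains \<open>D\<close>: p-consistency
  settles the subfamilies of premises, the failed inclusions those that also contain \<open>D\<close>, and the
  possibility of falsifying \<open>D\<close> settles \<open>D\<close> on its own.
\<close>

lemma p_entails_imp_quasi_conj_incl:
  fixes C :: "'i \<Rightarrow> 'a::boolean_algebra cond_event"
  assumes fin: "finite I" and C: "\<And>i. i \<in> I \<Longrightarrow> is_cond_event (C i)"
    and D: "status_event Is_False D \<noteq> \<bottom>" and entails: "p_entails I C D"
  shows "\<exists>J\<subseteq>I. J \<noteq> {} \<and> gn_incl (quasi_conj (C ` J)) D"
proof (rule ccontr)
  assume none: "\<not> ?thesis"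
  from entails have pc: "p_consistent I C" by (simp add: p_entails_def)
  from entails obtain K where K: "K \<subseteq> I"
    and ent: "\<And>a. a \<in> {0..<1::real} \<Longrightarrow> \<exists>\<alpha>. (\<forall>i\<in>K. \<alpha> i \<in> {0..<1}) \<and>
      (\<forall>z p. coherent (insert None (Some ` K)) (case_option D C) (case_option z p) \<longrightarrow>
        (\<forall>i\<in>K. \<alpha> i \<le> p i) \<longrightarrow> a \<le> z)"
    unfolding p_entails_def by blast
  let ?C = "case_option D C"
  have finK: "finite K" using fin K finite_subset by blast
  have "coherent (insert None (Some ` K)) ?C (\<lambda>i. of_bool (i \<noteq> None))"
  proof (rule coherent_of_bool)
    show "finite (insert None (Some ` K))" using finK by simp
  next
    fix J assume J: "J \<subseteq> insert None (Some ` K)" "J \<noteq> {}"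
    define S where "S = Some -` J"
    have S: "S \<subseteq> I" "finite S"
      using J(1) K finK by (auto simp: S_def intro: finite_subset[of _ K])
    have "J = (J \<inter> {None}) \<union> Some ` S"
      by (auto simp: S_def notin_range_Some)
    hence J_cases: "J = insert None (Some ` S) \<or> J = Some ` S"
      by (cases "None \<in> J") simp_all
    have sup_eq: "\<Squnion>\<^sub>f\<^sub>i\<^sub>n ((\<lambda>j. antec (?C j)) ` insert None (Some ` S)) =
        antec D \<squnion> \<Squnion>\<^sub>f\<^sub>i\<^sub>n (antec ` C ` S)" if "S \<noteq> {}"
      using S(2) that by (simp add: image_image Sup_fin.insert)
    have "\<exists>x. x \<noteq> \<bottom> \<and> x \<le> \<Squnion>\<^sub>f\<^sub>i\<^sub>n ((\<lambda>j. antec (?C j)) ` J) \<and>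
      (None \<in> J \<longrightarrow> x \<le> - status_event Is_True D) \<and>
      (\<forall>i\<in>S. x \<le> - status_event Is_False (C i))"
    proof (cases "S = {}")
      case True
      hence "J = {None}" using J_cases J(2) by auto
      thus ?thesis using True D
        by (intro exI[of _ "status_event Is_False D"]) (auto intro: le_infI1 le_supI1)
    next
      case ne: False
      show ?thesis
      proof (cases "None \<in> J")
        case True
        hence J_eq: "J = insert None (Some ` S)" using J_cases by auto
        have "\<not> gn_incl (quasi_conj (C ` S)) D" using none S(1) ne by blast
        then obtain x where "x \<noteq> \<bottom>" "x \<le> antec D \<squnion> \<Squnion>\<^sub>f\<^sub>i\<^sub>n (antec ` C ` S)"
          "x \<le> - status_event Is_True D" "\<And>c. c \<in> C ` S \<Longrightarrow> x \<le> - status_event Is_False c"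
          using not_gn_incl_quasi_conj[of "C ` S" D] S(2) ne by blast
        thus ?thesis unfolding J_eq sup_eq[OF ne] by blast
      next
        case False
        hence J_eq: "J = Some ` S" using J_cases by auto
        let ?q = "quasi_conj (C ` S)"
        have "conseq ?q \<noteq> \<bottom>"
          using p_consistent_imp_quasi_conj_verifiable[OF fin C pc S(1) ne] .
        moreover have "conseq ?q \<le> \<Squnion>\<^sub>f\<^sub>i\<^sub>n ((\<lambda>j. antec (?C j)) ` J)"
          by (simp add: J_eq image_image quasi_conj_def cond_def)
        moreover have "conseq ?q \<le> - status_event Is_False (C i)" if "i \<in> S" for i
        proof -
          have "conseq ?q \<le> \<Sqinter>\<^sub>f\<^sub>i\<^sub>n ((\<lambda>c. (conseq c \<sqinter> antec c) \<squnion> - antec c) ` C ` S)"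
            by (simp add: quasi_conj_def cond_def)
          also have "\<dots> \<le> (conseq (C i) \<sqinter> antec (C i)) \<squnion> - antec (C i)"
            using S(2) that by (intro Inf_fin.coboundedI) auto
          finally show ?thesis by (simp add: sup_inf_distrib2)
        qed
        ultimately show ?thesis using False by blast
      qed
    qed
    thus "\<exists>x. x \<noteq> \<bottom> \<and> x \<le> \<Squnion>\<^sub>f\<^sub>i\<^sub>n ((\<lambda>j. antec (?C j)) ` J) \<and>
      (\<forall>j\<in>J. x \<le> - status_event (if j \<noteq> None then Is_False else Is_True) (?C j))"
      by (elim ex_forward) (auto simp: S_def split: option.split simp del: status_event.simps)
  qed
  moreover have "(\<lambda>i :: 'i option. of_bool (i \<noteq> None)) = case_option (0::real) (\<lambda>_. 1)"
    by (auto split: option.split)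
  ultimately have coh: "coherent (insert None (Some ` K)) ?C (case_option 0 (\<lambda>_. 1))"
    by (simp only:)
  \<comment> \<open>Any positive threshold contradicts probability \<open>0\<close>.\<close>
  obtain \<alpha> where \<alpha>: "\<forall>i\<in>K. \<alpha> i \<in> {0..<1::real}"
    and "\<forall>z p. coherent (insert None (Some ` K)) ?C (case_option z p) \<longrightarrow>
        (\<forall>i\<in>K. \<alpha> i \<le> p i) \<longrightarrow> 1 / 2 \<le> z"
    using ent[of "1 / 2"] by auto
  with coh have "(\<forall>i\<in>K. \<alpha> i \<le> 1) \<longrightarrow> 1 / 2 \<le> (0::real)" by blast
  thus False using \<alpha> by force
qed

lemma qc_class_Union:
  assumes "finite F" "\<K> \<noteq> {}" "\<K> \<subseteq> qc_class F D"
  shows "\<Union>\<K> \<in> qc_class F D"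
proof -
  have "finite \<K>"
    using assms by (intro finite_subset[of \<K> "Pow F"]) (auto simp: qc_class_def)
  thus ?thesis using assms(2,3)
  proof (induction \<K> rule: finite_ne_induct)
    case (insert S \<K>)
    hence S: "S \<in> qc_class F D" and U: "\<Union>\<K> \<in> qc_class F D" by auto
    hence "finite S" "finite (\<Union>\<K>)"
      using assms(1) unfolding qc_class_def mem_Collect_eq by (meson finite_subset)+
    thus ?case
      using S U gn_incl_quasi_conj_Un[of S "\<Union>\<K>" D] unfolding qc_class_def by simp
  qed auto
qed

theorem theorem12:
  fixes n :: nat and F :: "nat \<Rightarrow> 'a::boolean_algebra cond_event" and E H :: 'a
  assumes "\<And>i. i \<in> {1..n} \<Longrightarrow> is_cond_event (F i)"
    and "H \<noteq> \<bottom>"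
    and "\<not> H \<le> E"
    and "p_entails {1..n} F (cond E H)"
  shows "qc_class (F ` {1..n}) (cond E H) \<noteq> {} \<and>
    (\<exists>S' \<in> qc_class (F ` {1..n}) (cond E H).
       \<forall>S \<in> qc_class (F ` {1..n}) (cond E H). S \<subseteq> S')"
proof -
  let ?K = "qc_class (F ` {1..n}) (cond E H)"
  have "status_event Is_False (cond E H) = H \<sqinter> - E"
    by (simp add: cond_def inf_sup_distrib2) (rule inf.commute)
  moreover have "H \<sqinter> - E \<noteq> \<bottom>"
    using assms(3) by (simp only: inf_shunt double_compl not_False_eq_True)
  ultimately have "status_event Is_False (cond E H) \<noteq> \<bottom>" by (simp only: not_False_eq_True)
  then obtain J where "J \<subseteq> {1..n}" "J \<noteq> {}" "gn_incl (quasi_conj (F ` J)) (cond E H)"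
    using p_entails_imp_quasi_conj_incl[OF finite_atLeastAtMost assms(1) _ assms(4)] by blast
  hence "F ` J \<in> ?K" by (auto simp: qc_class_def)
  hence ne: "?K \<noteq> {}" by blast
  moreover have "\<Union>?K \<in> ?K" using ne by (intro qc_class_Union) auto
  ultimately show ?thesis by blast
qed

end
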